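(* Let $n\geq 3$ be an integer. If $q$ is the smallest prime power such that $q\geq 2n+1$, then $\chi(\mathcal{M}(K_{2n}))\leq q$.
   Context: $K_{2n}$ is the complete graph on $2n$ vertices. The flip graph $\mathcal{M}(K_{2n})$ is the graph whose vertices are the perfect matchings of $K_{2n}$, where two perfect matchings are adjacent if their symmetric difference (as edge sets) is a cycle of length $4$. $\chi(G)$ denotes the chromatic number of a graph $G$. *)

theory Defs
  imports
    "HOL-Number_Theory.Prime_Powers"
    "HOL-Library.Ramsey"
    "HOL-Library.Extended_Nat"
begin

text \<open>Graphs are undirected and simple: every edge is a two-element set of vertices.\<close>

record 'a ugraph =
  verts :: "'a set"
  edges :: "'a set set"

definition simple_graph :: "'a ugraph \<Rightarrow> bool" where
  "simple_graph G \<longleftrightarrow> edges G \<subseteq> [verts G]\<^bsup>2\<^esup>"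

definition complete_graph :: "nat \<Rightarrow> nat ugraph" where
  "complete_graph m = \<lparr>verts = {..<m}, edges = [{..<m}]\<^bsup>2\<^esup>\<rparr>"

definition perfect_matching :: "'a ugraph \<Rightarrow> 'a set set \<Rightarrow> bool" where
  "perfect_matching G M \<longleftrightarrow> M \<subseteq> edges G \<and> (\<forall>v\<in>verts G. \<exists>!e. e \<in> M \<and> v \<in> e)"

definition is_cycle :: "nat \<Rightarrow> 'a set set \<Rightarrow> bool" where
  "is_cycle k C \<longleftrightarrow> k \<ge> 3 \<and>
     (\<exists>vs. length vs = k \<and> distinct vs \<and> C = {{vs ! i, vs ! (Suc i mod k)} | i. i < k})"

definition flip_graph :: "'a ugraph \<Rightarrow> 'a set set ugraph" where
  "flip_graph G =
     \<lparr>verts = {M. perfect_matching G M},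
      edges = {{M, N} | M N. perfect_matching G M \<and> perfect_matching G N \<and>
                             is_cycle 4 (sym_diff M N)}\<rparr>"

definition proper_colouring :: "'a ugraph \<Rightarrow> nat \<Rightarrow> ('a \<Rightarrow> nat) \<Rightarrow> bool" where
  "proper_colouring G k c \<longleftrightarrow>
     (\<forall>v\<in>verts G. c v < k) \<and> (\<forall>u v. {u, v} \<in> edges G \<longrightarrow> c u \<noteq> c v)"

text \<open>The value is \<^term>\<open>\<infinity>\<close> if there is no proper colouring with finitely many colours.\<close>

definition chromatic_number :: "'a ugraph \<Rightarrow> enat" where
  "chromatic_number G = (INF k \<in> {k. \<exists>c. proper_colouring G k c}. enat k)"

lemma simple_graph_complete_graph: "simple_graph (complete_graph m)"
  by (simp add: simple_graph_def complete_graph_def)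

lemma simple_graph_flip_graph: "simple_graph (flip_graph G)"
proof -
  have "\<not> is_cycle 4 ({} :: 'a set set)"
    by (auto simp: is_cycle_def intro: exI[of _ 0])
  then have "M \<noteq> N" if "is_cycle 4 (sym_diff M N)" for M N :: "'a set set"
    using that by auto
  then show ?thesis
    by (fastforce simp: simple_graph_def flip_graph_def nsets_def)
qed

end

theory Submission
  imports Defs "HOL-Computational_Algebra.Fundamental_Theorem_Algebra"
begin

text \<open>
  Label the vertices by distinct elements \<open>x\<^sub>v\<close> of the field with \<open>q\<close> elements and colour a perfect
  matching \<open>M\<close> by the sum of \<open>x\<^sub>u x\<^sub>v\<close> over its edges \<open>{u, v}\<close>. A flip replaces two edges \<open>{a, b}\<close>,
  \<open>{c, d}\<close> by \<open>{b, c}\<close>, \<open>{d, a}\<close>, and it changes the colour by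
  \<open>x\<^sub>a x\<^sub>b + x\<^sub>c x\<^sub>d - x\<^sub>b x\<^sub>c - x\<^sub>d x\<^sub>a = (x\<^sub>a - x\<^sub>c) (x\<^sub>b - x\<^sub>d)\<close>,
  which is nonzero (\<open>matching_weight_flip\<close>). So adjacent matchings get different colours as soon as
  there are enough labels.

  The field is obtained without a type or a quotient structure, as the residue field of a prime ideal
  \<open>P\<close> of \<open>\<int>[X]\<close> (\<open>exists_residue_field\<close>). Let \<open>q = p ^ k\<close>, \<open>m = q - 1\<close>, and let \<open>\<zeta>\<close> be a primitive
  complex \<open>m\<close>-th root of unity. The prime \<open>p\<close> is not invertible in \<open>\<int>[\<zeta>]\<close>
  (\<open>prime_not_unit_at_root_of_unity\<close>), so Zorn's lemma gives a prime ideal \<open>P\<close> that contains \<open>p\<close> and all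
  polynomials vanishing at \<open>\<zeta>\<close>. Modulo \<open>P\<close> the map \<open>f \<mapsto> f ^ q\<close> is additive, multiplicative and
  fixes \<open>X\<close>, hence it is the identity; since \<open>f \<cdot> (\<Prod>i<m. f - X ^ i)\<close> agrees with \<open>f ^ q - f\<close> at \<open>\<zeta>\<close>,
  each \<open>f\<close> is congruent to one of \<open>0, 1, X, \<dots>, X ^ (m - 1)\<close>. These \<open>q\<close> elements are pairwise
  incongruent: \<open>X ^ d \<equiv> 1\<close> with \<open>0 < d < m\<close> would turn the geometric sum \<open>\<Sum>t<m. \<zeta> ^ (d t) = 0\<close> into
  \<open>m \<equiv> 0\<close>, while \<open>m = q - 1 \<equiv> -1\<close>.
\<close>

section \<open>Primes in cyclotomic rings\<close>

text \<open>
  A form of Nakayama's lemma for the integers localised at \<open>p\<close>: a finitely generated torsion-free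
  module that equals \<open>p\<close> times itself vanishes. The generators are eliminated one at a time. Solving
  the relation of \<open>v a\<close> for \<open>v a\<close> has leading coefficient \<open>s - p * c a\<close>, which stays prime to \<open>p\<close>; the
  denominators \<open>s\<close> in the hypothesis exist to make this step possible over the integers.
\<close>

lemma vanish_if_in_prime_multiples_of_span:
  fixes v :: "'i \<Rightarrow> 'a::field_char_0" and p :: int
  assumes "finite I" and p: "prime p"
    and "\<And>i. i \<in> I \<Longrightarrow> \<exists>s c. \<not> p dvd s \<and>
           of_int s * v i = of_int p * (\<Sum>j\<in>I. of_int (c j) * v j)"
    and "i \<in> I"
  shows "v i = 0"
  using assms(1,3,4)
proof (induction I arbitrary: i rule: finite_induct)
  case (insert a I)
  obtain s c where s: "\<not> p dvd s"
    and sc: "of_int s * v a = of_int p * (\<Sum>j\<in>insert a I. of_int (c j) * v j)"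
    using insert.prems(1)[of a] by auto
  define t where "t = s - p * c a"
  have t: "\<not> p dvd t"
    using s unfolding t_def by (metis dvd_triv_left dvd_diff_commute dvd_diff diff_add_cancel dvd_add)
  have ta: "of_int t * v a = of_int p * (\<Sum>j\<in>I. of_int (c j) * v j)"
    using sc insert.hyps by (simp add: t_def algebra_simps)
  have "v j = 0" if "j \<in> I" for j
  proof (rule insert.IH[OF _ that])
    fix i assume "i \<in> I"
    then obtain u d where u: "\<not> p dvd u"
      and ud: "of_int u * v i = of_int p * (\<Sum>j\<in>insert a I. of_int (d j) * v j)"
      using insert.prems(1)[of i] by auto
    \<comment> \<open>Multiply the relation of \<open>v i\<close> by \<open>t\<close> and substitute \<open>of_int t * v a\<close>; \<open>b\<close> collects the new
      coefficients.\<close>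
    define b where "b j = d a * p * c j + t * d j" for j
    have "of_int (t * u) * v i = of_int p * (of_int (d a) * (of_int t * v a)
        + of_int t * (\<Sum>j\<in>I. of_int (d j) * v j))"
      using ud insert.hyps by (simp add: algebra_simps)
    also have "\<dots> = of_int p * (\<Sum>j\<in>I. of_int (b j) * v j)"
      unfolding ta b_def by (simp add: sum_distrib_left sum.distrib algebra_simps)
    finally show "\<exists>s c. \<not> p dvd s \<and>
           of_int s * v i = of_int p * (\<Sum>j\<in>I. of_int (c j) * v j)"
      using t u p prime_dvd_mult_iff by blast
  qed
  moreover from this have "of_int t * v a = 0"
    unfolding ta by simp
  moreover have "t \<noteq> 0"
    using t by auto
  ultimately show ?case
    using insert.prems(2) by auto
qed simp

definition eval_int_poly :: "int poly \<Rightarrow> 'a::comm_ring_1 \<Rightarrow> 'a" where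
  "eval_int_poly f z = poly (map_poly of_int f) z"

lemma eval_int_poly_0 [simp]: "eval_int_poly 0 z = 0"
  by (simp add: eval_int_poly_def)

lemma eval_int_poly_pCons [simp]:
  "eval_int_poly (pCons a f) z = of_int a + z * eval_int_poly f z"
  by (simp add: eval_int_poly_def map_poly_pCons)

lemma eval_int_poly_1 [simp]: "eval_int_poly 1 z = 1"
  by (simp add: one_pCons)

lemma eval_int_poly_add [simp]:
  "eval_int_poly (f + g) z = eval_int_poly f z + eval_int_poly g z"
  by (induction f g rule: poly_induct2) (simp_all add: algebra_simps)

lemma eval_int_poly_smult [simp]:
  "eval_int_poly (smult a f) z = of_int a * eval_int_poly f z"
  by (induction f) (simp_all add: algebra_simps)

lemma eval_int_poly_mult [simp]:
  "eval_int_poly (f * g) z = eval_int_poly f z * eval_int_poly g z"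
  by (induction f) (simp_all add: algebra_simps)

lemma eval_int_poly_diff [simp]:
  "eval_int_poly (f - g) z = eval_int_poly f z - eval_int_poly g z"
  using eval_int_poly_add[of "f - g" g z] by simp

lemma eval_int_poly_power [simp]: "eval_int_poly (f ^ n) z = eval_int_poly f z ^ n"
  by (induction n) simp_all

lemma eval_int_poly_sum [simp]:
  "eval_int_poly (\<Sum>i\<in>A. f i) z = (\<Sum>i\<in>A. eval_int_poly (f i) z)"
  by (induction A rule: infinite_finite_induct) simp_all

lemma eval_int_poly_prod [simp]:
  "eval_int_poly (\<Prod>i\<in>A. f i) z = (\<Prod>i\<in>A. eval_int_poly (f i) z)"
  by (induction A rule: infinite_finite_induct) simp_all

lemma eval_int_poly_of_nat [simp]: "eval_int_poly (of_nat n) z = of_nat n"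
  by (induction n) simp_all

lemma eval_int_poly_at_root_of_unity:
  fixes z :: "'a::comm_ring_1"
  assumes "z ^ m = 1" "m > 0"
  shows "\<exists>c. eval_int_poly f z = (\<Sum>i<m. of_int (c i) * z ^ i)"
proof (induction f)
  case 0
  show ?case by (rule exI[of _ "\<lambda>_. 0"]) simp
next
  case (pCons a f)
  then obtain c where c: "eval_int_poly f z = (\<Sum>i<m. of_int (c i) * z ^ i)" by blast
  obtain k where m: "m = Suc k" using assms(2) by (cases m) auto
  \<comment> \<open>Multiplication by \<open>z\<close> rotates the coefficients, because \<open>z ^ m = 1\<close>.\<close>
  define d where "d i = (case i of 0 \<Rightarrow> a + c k | Suc j \<Rightarrow> c j)" for i
  have "eval_int_poly (pCons a f) z = of_int a + (\<Sum>i<k. of_int (c i) * z ^ Suc i) + of_int (c k) * z ^ m"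
    by (simp add: c m sum_distrib_left algebra_simps)
  also have "\<dots> = (\<Sum>i<m. of_int (d i) * z ^ i)"
    unfolding assms(1) unfolding m sum.lessThan_Suc_shift by (simp add: d_def)
  finally show ?case by blast
qed

text \<open>
  If \<open>p\<close> were invertible in the ring generated by \<open>z\<close>, each of its generators \<open>1, z, \<dots>, z ^ (m - 1)\<close>
  would be \<open>p\<close> times an integral combination of them, so that all of them would vanish.
\<close>
lemma prime_not_unit_at_root_of_unity:
  fixes z :: "'a::field_char_0"
  assumes "z ^ m = 1" "m > 0" "prime p"
  shows "of_nat p * eval_int_poly f z \<noteq> 1"
proof
  assume eq: "of_nat p * eval_int_poly f z = 1"
  have "z ^ 0 = 0"
  proof (rule vanish_if_in_prime_multiples_of_span[where v = "\<lambda>i. z ^ i" and I = "{..<m}" and p = "int p"])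
    fix i assume "i \<in> {..<m}"
    obtain c where "eval_int_poly (f * [:0, 1:] ^ i) z = (\<Sum>j<m. of_int (c j) * z ^ j)"
      using eval_int_poly_at_root_of_unity assms(1,2) by blast
    hence "of_int 1 * z ^ i = of_int (int p) * (\<Sum>j<m. of_int (c j) * z ^ j)"
      using arg_cong[OF eq, of "\<lambda>x. x * z ^ i"] by (simp add: algebra_simps)
    moreover have "\<not> int p dvd 1"
      using assms(3) by (metis not_prime_unit prime_nat_int_transfer)
    ultimately show "\<exists>s c. \<not> int p dvd s \<and> of_int s * z ^ i = of_int (int p) * (\<Sum>j<m. of_int (c j) * z ^ j)"
      by blast
  qed (use assms in auto)
  thus False by simp
qed

section \<open>Prime ideals and the Frobenius map\<close>

locale proper_ideal =
  fixes I :: "'a::comm_ring_1 set"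
  assumes zero_mem: "0 \<in> I"
    and add_mem: "x \<in> I \<Longrightarrow> y \<in> I \<Longrightarrow> x + y \<in> I"
    and mult_mem: "x \<in> I \<Longrightarrow> r * x \<in> I"
    and one_not_mem: "1 \<notin> I"
begin

lemma uminus_mem: "x \<in> I \<Longrightarrow> - x \<in> I"
  using mult_mem[of x "-1"] by simp

lemma diff_mem: "x \<in> I \<Longrightarrow> y \<in> I \<Longrightarrow> x - y \<in> I"
  using add_mem[OF _ uminus_mem] by fastforce

lemma sum_mem: "(\<And>i. i \<in> A \<Longrightarrow> f i \<in> I) \<Longrightarrow> sum f A \<in> I"
  by (induction A rule: infinite_finite_induct) (auto simp: zero_mem add_mem)

lemma power_cong:
  assumes "x - y \<in> I"
  shows "x ^ n - y ^ n \<in> I"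
  unfolding power_diff_sumr2 using mult_mem[OF assms] by (subst mult.commute) blast

text \<open>For \<open>k = 1\<close>, \<open>p\<close> divides all inner binomial coefficients; the general case iterates this.\<close>
lemma frobenius_add:
  assumes p: "prime p" and "of_nat p \<in> I"
  shows "(x + y) ^ p ^ k - (x ^ p ^ k + y ^ p ^ k) \<in> I"
proof (induction k)
  case 0
  show ?case by (simp add: zero_mem)
next
  case (Suc k)
  have one: "(a + b) ^ p - (a ^ p + b ^ p) \<in> I" for a b
  proof -
    have "p > 0" using p prime_gt_0_nat by blast
    have "(a + b) ^ p = (\<Sum>i\<le>p. of_nat (p choose i) * a ^ i * b ^ (p - i))"
      by (rule binomial_ring)
    also have "{..p} = insert 0 (insert p {0<..<p})" by auto
    finally have "(a + b) ^ p - (a ^ p + b ^ p)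
        = (\<Sum>i\<in>{0<..<p}. of_nat (p choose i) * a ^ i * b ^ (p - i))"
      using \<open>p > 0\<close> by (simp add: algebra_simps)
    also have "\<dots> \<in> I"
    proof (rule sum_mem)
      fix i assume "i \<in> {0<..<p}"
      then obtain l where "p choose i = p * l"
        using dvd_choose_prime[of i p] p by (auto elim!: dvdE)
      hence "of_nat (p choose i) * a ^ i * b ^ (p - i) = (of_nat l * a ^ i * b ^ (p - i)) * of_nat p"
        by (simp add: algebra_simps)
      thus "of_nat (p choose i) * a ^ i * b ^ (p - i) \<in> I"
        using mult_mem assms(2) by simp
    qed
    finally show ?thesis .
  qed
  have "((x + y) ^ p ^ k) ^ p - (x ^ p ^ k + y ^ p ^ k) ^ p \<in> I"
    by (rule power_cong[OF Suc.IH])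
  from add_mem[OF this one[of "x ^ p ^ k" "y ^ p ^ k"]] show ?case
    unfolding power_Suc2 power_mult by (simp only: diff_add_cancel diff_add_eq add_diff_eq)
qed

end

locale prime_ideal = proper_ideal +
  assumes prime_mem: "x * y \<in> I \<Longrightarrow> x \<in> I \<or> y \<in> I"

text \<open>
  A proper ideal \<open>P\<close> that is maximal above \<open>I\<close> exists by Zorn's lemma, and it is prime: if
  \<open>x, y \<notin> P\<close>, then \<open>1 \<in> P + R x\<close> and \<open>1 \<in> P + R y\<close>, and the product of the two representations of \<open>1\<close>
  lies in \<open>P\<close> once \<open>x * y\<close> does.
\<close>
lemma (in proper_ideal) exists_prime_ideal: "\<exists>P. prime_ideal P \<and> I \<subseteq> P"
proof -
  let ?A = "{J. proper_ideal J \<and> I \<subseteq> J}"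
  have "\<exists>P\<in>?A. \<forall>J\<in>?A. P \<subseteq> J \<longrightarrow> J = P"
  proof (rule subset_Zorn_nonempty)
    show "?A \<noteq> {}" using proper_ideal_axioms by auto
  next
    fix C assume C: "C \<noteq> {}" "subset.chain ?A C"
    have ideal: "proper_ideal J" and above: "I \<subseteq> J" if "J \<in> C" for J
      using C(2) that by (auto simp: subset_chain_def)
    have "proper_ideal (\<Union>C)"
    proof
      fix x y assume "x \<in> \<Union>C" "y \<in> \<Union>C"
      then obtain J where "J \<in> C" "x \<in> J" "y \<in> J"
        using C(2) unfolding subset_chain_def by (meson UnionE subsetD)
      thus "x + y \<in> \<Union>C"
        using proper_ideal.add_mem[OF ideal] by blast
    qed (use C(1) ideal proper_ideal.zero_mem proper_ideal.mult_mem proper_ideal.one_not_mem in blast)+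
    moreover have "I \<subseteq> \<Union>C" using C(1) above by blast
    ultimately show "\<Union>C \<in> ?A" by simp
  qed
  then obtain P where P: "proper_ideal P" "I \<subseteq> P"
    and maximal: "\<And>J. proper_ideal J \<Longrightarrow> P \<subseteq> J \<Longrightarrow> J = P"
    by auto
  interpret P: proper_ideal P by fact
  have comaximal: "\<exists>u r. u \<in> P \<and> 1 = u + r * a" if "a \<notin> P" for a
  proof (rule ccontr)
    assume contra: "\<not> ?thesis"
    let ?J = "{u + r * a | u r. u \<in> P}"
    have "P \<subseteq> ?J"
      by (force intro: exI[of _ 0])
    moreover have "a \<in> ?J"
      using P.zero_mem by (force intro: exI[of _ 0] exI[of _ 1])
    moreover have "proper_ideal ?J"
    proof
      show "0 \<in> ?J" using P.zero_mem \<open>P \<subseteq> ?J\<close> by blast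
      show "1 \<notin> ?J" using contra by auto
    next
      fix x y assume "x \<in> ?J" "y \<in> ?J"
      then obtain u r w s where "x = u + r * a" "y = w + s * a" "u \<in> P" "w \<in> P" by auto
      hence "x + y = (u + w) + (r + s) * a" "u + w \<in> P"
        by (simp_all add: algebra_simps P.add_mem)
      thus "x + y \<in> ?J" by blast
    next
      fix x t assume "x \<in> ?J"
      then obtain u r where "x = u + r * a" "u \<in> P" by auto
      hence "t * x = t * u + (t * r) * a" "t * u \<in> P"
        by (simp_all add: algebra_simps P.mult_mem)
      thus "t * x \<in> ?J" by blast
    qed
    ultimately show False using maximal that by blast
  qed
  have "prime_ideal P"
  proof
    fix x y assume xy: "x * y \<in> P"
    show "x \<in> P \<or> y \<in> P"
    proof (rule ccontr)
      assume "\<not> (x \<in> P \<or> y \<in> P)"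
      then obtain u r w s where u: "u \<in> P" "1 = u + r * x" and w: "w \<in> P" "1 = w + s * y"
        using comaximal by metis
      have "1 = (u + r * x) * (w + s * y)" using u(2) w(2) by simp
      also have "\<dots> = (w + s * y) * u + r * x * w + r * s * (x * y)"
        by (simp add: algebra_simps)
      also have "\<dots> \<in> P"
        using u(1) w(1) xy by (simp add: P.add_mem P.mult_mem)
      finally show False using P.one_not_mem by simp
    qed
  qed
  thus ?thesis using P(2) by blast
qed

section \<open>Finite fields as residue fields\<close>

lemma prod_diff_root_of_unity_powers:
  fixes x :: complex
  assumes "m > 0"
  defines "z \<equiv> cis (2 * pi / real m)"
  shows "(\<Prod>i<m. x - z ^ i) = x ^ m - 1"
proof -
  let ?f = "monom 1 m - 1 :: complex poly"
  have bij: "bij_betw (\<lambda>i. z ^ i) {..<m} {w. w ^ m = 1}"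
    using bij_betw_roots_unity[OF assms(1)] unfolding z_def by (simp add: DeMoivre mult_ac)
  have deg: "degree ?f = m"
    using assms(1) by (subst diff_conv_add_uminus, subst degree_add_eq_left) (simp_all add: degree_monom_eq)
  have lead: "lead_coeff ?f = 1"
    unfolding deg using assms(1) by simp
  have "rsquarefree ?f"
  proof (rule rsquarefree_roots[THEN iffD2], intro allI notI)
    fix a assume a: "poly ?f a = 0 \<and> poly (pderiv ?f) a = 0"
    hence "a ^ m = 1" "a ^ (m - 1) = 0"
      using assms(1) by (auto simp: poly_monom pderiv_diff pderiv_monom)
    thus False using assms(1) by (cases m) auto
  qed
  from complex_poly_decompose_rsquarefree[OF this]
  have "?f = (\<Prod>w | w ^ m = 1. [:- w, 1:])"
    unfolding lead by (simp add: poly_monom)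
  also have "\<dots> = (\<Prod>i<m. [:- (z ^ i), 1:])"
    by (rule prod.reindex_bij_betw[OF bij, symmetric])
  finally have "poly ?f x = poly (\<Prod>i<m. [:- (z ^ i), 1:]) x" by simp
  thus ?thesis by (simp add: poly_monom poly_prod)
qed


lemma (in prime_ideal) prod_mem_iff:
  assumes "finite A"
  shows "(\<Prod>i\<in>A. f i) \<in> I \<longleftrightarrow> (\<exists>i\<in>A. f i \<in> I)"
  using assms
proof (induction A rule: finite_induct)
  case empty
  show ?case by (simp add: one_not_mem)
next
  case (insert a A)
  thus ?case
    using prime_mem mult_mem by (metis mult.commute insert_iff prod.insert)
qed

text \<open>
  A field with \<open>q\<close> elements, presented as \<open>\<int>[X]\<close> modulo \<open>P\<close> with a system \<open>e 0, \<dots>, e (q - 1)\<close> of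
  representatives.
\<close>
lemma exists_residue_field:
  fixes q :: nat
  assumes "primepow q"
  shows "\<exists>(P :: int poly set) e. prime_ideal P \<and> (\<forall>f. \<exists>i<q. f - e i \<in> P) \<and>
           (\<forall>i<q. \<forall>j<q. i \<noteq> j \<longrightarrow> e i - e j \<notin> P)"
proof -
  obtain p k where p: "prime p" and k: "k > 0" and q: "q = p ^ k"
    using assms by (auto simp: primepow_def)
  have "q \<ge> 2"
    using assms primepow_gt_Suc_0[of q] by linarith
  define m where "m = q - 1"
  have m: "m > 0" "q = Suc m" using \<open>q \<ge> 2\<close> by (auto simp: m_def)
  define z where "z = cis (2 * pi / real m)"
  have bij: "bij_betw (\<lambda>i. z ^ i) {..<m} {w. w ^ m = 1}"
    using bij_betw_roots_unity[OF m(1)] unfolding z_def by (simp add: DeMoivre mult_ac)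
  have zm: "z ^ m = 1"
    using m(1) by (simp add: z_def DeMoivre)
  have z_power: "(z ^ i) ^ m = 1" for i
    by (metis mult.commute power_mult power_one zm)
  have z_primitive: "z ^ d \<noteq> 1" if "0 < d" "d < m" for d
    using inj_onD[OF bij_betw_imp_inj_on[OF bij], of d 0] that m(1) by auto

  \<comment> \<open>The preimage of the ideal \<open>p \<int>[z]\<close> under evaluation at \<open>z\<close>.\<close>
  define I where "I = {f. \<exists>g. eval_int_poly f z = of_nat p * eval_int_poly g z}"
  have "proper_ideal I"
  proof
    show "0 \<in> I" by (auto simp: I_def intro: exI[of _ 0])
    show "1 \<notin> I"
      using prime_not_unit_at_root_of_unity[OF zm m(1) p] by (simp add: I_def eq_commute[of 1])
  next
    fix f g assume "f \<in> I" "g \<in> I"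
    then obtain f' g' where "eval_int_poly f z = of_nat p * eval_int_poly f' z"
      "eval_int_poly g z = of_nat p * eval_int_poly g' z" by (auto simp: I_def)
    hence "eval_int_poly (f + g) z = of_nat p * eval_int_poly (f' + g') z"
      by (simp add: algebra_simps)
    thus "f + g \<in> I" unfolding I_def by blast
  next
    fix f h assume "f \<in> I"
    then obtain f' where "eval_int_poly f z = of_nat p * eval_int_poly f' z"
      by (auto simp: I_def)
    hence "eval_int_poly (h * f) z = of_nat p * eval_int_poly (h * f') z"
      by (simp add: algebra_simps)
    thus "h * f \<in> I" unfolding I_def by blast
  qed
  then obtain P where "prime_ideal P" and "I \<subseteq> P"
    using proper_ideal.exists_prime_ideal by blast
  interpret P: prime_ideal P by fact
  have kernel: "f \<in> P" if "eval_int_poly f z = 0" for f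
  proof -
    have "f \<in> I"
      unfolding I_def mem_Collect_eq using that by (intro exI[of _ 0]) simp
    thus ?thesis using \<open>I \<subseteq> P\<close> by blast
  qed
  have "of_nat p \<in> I"
    unfolding I_def mem_Collect_eq by (intro exI[of _ 1]) simp
  hence p_mem: "of_nat p \<in> P"
    using \<open>I \<subseteq> P\<close> by blast
  have m_notin: "of_nat m \<notin> P"
  proof
    assume "of_nat m \<in> P"
    moreover have "of_nat q \<in> P"
      using P.mult_mem[OF p_mem, of "of_nat p ^ (k - 1)"] k
      by (cases k) (simp_all add: q mult.commute)
    ultimately have "of_nat q - of_nat m \<in> P" by (rule P.diff_mem[rotated])
    thus False using P.one_not_mem by (simp add: m(2))
  qed

  define X where "X = [:0, 1 :: int:]"
  have ev_X [simp]: "eval_int_poly X z = z" by (simp add: X_def)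
  have X_notin: "X ^ i \<notin> P" for i
  proof
    assume "X ^ i \<in> P"
    hence "(X ^ i) ^ m \<in> P" using P.mult_mem[of _ "(X ^ i) ^ (m - 1)"] m(1)
      by (cases m) (simp_all add: mult.commute)
    moreover have "(X ^ i) ^ m - 1 \<in> P"
      by (rule kernel) (simp add: z_power)
    ultimately show False using P.diff_mem P.one_not_mem by fastforce
  qed
  have distinct_powers: "X ^ j - X ^ i \<notin> P" if "i < j" "j < m" for i j
  proof
    define d where "d = j - i"
    have d: "0 < d" "d < m" "j = i + d" using that by (auto simp: d_def)
    assume "X ^ j - X ^ i \<in> P"
    hence "X ^ i * (X ^ d - 1) \<in> P" by (simp add: d(3) power_add algebra_simps)
    hence "X ^ d - 1 \<in> P" using P.prime_mem X_notin by blast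
    hence "(X ^ d) ^ t - 1 ^ t \<in> P" for t by (rule P.power_cong)
    hence "(\<Sum>t<m. (X ^ d) ^ t - 1 ^ t) \<in> P" by (intro P.sum_mem)
    moreover have "(\<Sum>t<m. (X ^ d) ^ t) \<in> P"
    proof (rule kernel)
      have "(z ^ d) ^ m = 1"
        by (rule z_power)
      thus "eval_int_poly (\<Sum>t<m. (X ^ d) ^ t) z = 0"
        using z_primitive[OF d(1,2)] by (simp add: sum_gp_strict)
    qed
    ultimately have "(\<Sum>t<m. (X ^ d) ^ t) - (\<Sum>t<m. (X ^ d) ^ t - 1 ^ t) \<in> P"
      by (intro P.diff_mem)
    thus False using m_notin by (simp add: sum_subtractf)
  qed

  \<comment> \<open>The polynomials with \<open>f ^ q \<equiv> f\<close> form a subring containing \<open>X\<close>, hence they are all polynomials.\<close>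
  have frob_add: "(f + g) ^ q - (f + g) \<in> P" if "f ^ q - f \<in> P" "g ^ q - g \<in> P" for f g
  proof -
    have "(f + g) ^ q - (f ^ q + g ^ q) + ((f ^ q - f) + (g ^ q - g)) \<in> P"
      unfolding q by (intro P.add_mem P.frobenius_add p p_mem that[unfolded q])
    thus ?thesis by (simp add: algebra_simps)
  qed
  have frob_mult: "(f * g) ^ q - f * g \<in> P" if "f ^ q - f \<in> P" "g ^ q - g \<in> P" for f g
  proof -
    have "g ^ q * (f ^ q - f) + f * (g ^ q - g) \<in> P"
      by (intro P.add_mem P.mult_mem that)
    thus ?thesis by (simp add: algebra_simps power_mult_distrib)
  qed
  have frob_uminus: "(- f) ^ q - (- f) \<in> P" if "f ^ q - f \<in> P" for f
  proof -
    have "(f + - f) ^ q - (f ^ q + (- f) ^ q) \<in> P"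
      unfolding q by (intro P.frobenius_add p p_mem)
    hence "0 - (f ^ q + (- f) ^ q) \<in> P"
      using m(2) by simp
    from P.uminus_mem[OF P.add_mem[OF this that]] show ?thesis
      by (simp add: algebra_simps)
  qed
  have frob_of_nat: "of_nat n ^ q - of_nat n \<in> P" for n
  proof (induction n)
    case 0
    show ?case using m(2) P.zero_mem by simp
  next
    case (Suc n)
    thus ?case using frob_add[of 1 "of_nat n"] P.zero_mem by simp
  qed
  have frob_of_int: "of_int a ^ q - of_int a \<in> P" for a
  proof (cases a)
    case (nonneg n)
    thus ?thesis using frob_of_nat[of n] by simp
  next
    case (neg n)
    thus ?thesis using frob_uminus[OF frob_of_nat[of "Suc n"]] by simp
  qed
  have frob: "f ^ q - f \<in> P" for f
  proof (induction f)
    case 0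
    show ?case using m(2) P.zero_mem by simp
  next
    case (pCons a f)
    have "X ^ q - X \<in> P"
      by (rule kernel) (simp add: m(2) zm)
    hence "(of_int a + X * f) ^ q - (of_int a + X * f) \<in> P"
      by (intro frob_add frob_mult frob_of_int pCons.IH)
    moreover have "pCons a f = of_int a + X * f"
      by (simp add: X_def of_int_poly)
    ultimately show ?case by simp
  qed

  define e where "e i = (case i of 0 \<Rightarrow> 0 | Suc j \<Rightarrow> X ^ j)" for i
  have "\<exists>i<q. f - e i \<in> P" for f
  proof -
    have "f * (\<Prod>i<m. f - X ^ i) - (f ^ q - f) \<in> P"
    proof (rule kernel)
      have eq: "(\<Prod>i<m. eval_int_poly f z - z ^ i) = eval_int_poly f z ^ m - 1"
        unfolding z_def by (rule prod_diff_root_of_unity_powers[OF m(1)])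
      show "eval_int_poly (f * (\<Prod>i<m. f - X ^ i) - (f ^ q - f)) z = 0"
        by (simp add: eq m(2) right_diff_distrib)
    qed
    from P.add_mem[OF this frob[of f]] have "f * (\<Prod>i<m. f - X ^ i) \<in> P" by simp
    then consider "f \<in> P" | "(\<Prod>i<m. f - X ^ i) \<in> P"
      using P.prime_mem by blast
    thus ?thesis
    proof cases
      case 1
      thus ?thesis using m(2) by (intro exI[of _ 0]) (simp add: e_def)
    next
      case 2
      then obtain i where "i < m" "f - X ^ i \<in> P"
        by (auto simp: P.prod_mem_iff)
      thus ?thesis using m(2) by (intro exI[of _ "Suc i"]) (simp add: e_def)
    qed
  qed
  moreover have lt: "e j - e i \<notin> P" if "i < j" "j < q" for i j
  proof -
    obtain j' where j: "j = Suc j'" using \<open>i < j\<close> by (cases j) auto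
    show ?thesis
      using that X_notin distinct_powers m(2) by (cases i) (auto simp: e_def j)
  qed
  have "e i - e j \<notin> P" if "i < q" "j < q" "i \<noteq> j" for i j
    using lt[of i j] lt[of j i] that P.uminus_mem[of "e i - e j"] by (cases "i < j") auto
  ultimately show ?thesis using \<open>prime_ideal P\<close> by blast
qed

section \<open>Flips of perfect matchings\<close>

definition matching_weight :: "('a \<Rightarrow> 'b::comm_ring_1) \<Rightarrow> 'a set set \<Rightarrow> 'b" where
  "matching_weight x M = (\<Sum>e\<in>M. \<Prod>v\<in>e. x v)"

text \<open>
  Stated for arbitrary elements in place of edges, so that automation does not unfold the edges into
  their vertices.
\<close>
lemma alternating_union:
  assumes "A \<union> B = {e, f, g, h}" and "A \<inter> B = {}"
    and "e \<in> A \<longleftrightarrow> f \<in> B" "f \<in> A \<longleftrightarrow> g \<in> B" "g \<in> A \<longleftrightarrow> h \<in> B"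
  shows "(A = {e, g} \<and> B = {f, h}) \<or> (A = {f, h} \<and> B = {e, g})"
proof (cases "e \<in> A")
  case True
  have "g \<in> A" "f \<in> B" "h \<in> B" using True assms by blast+
  hence "A = {e,g}" "B = {f,h}" using True assms(1,2) by fast+
  thus ?thesis by simp
next
  case False
  hence "e \<in> B" "f \<in> A" "g \<in> B" "h \<in> A" using assms by blast+
  hence "A = {f,h}" "B = {e,g}" using assms(1,2) by fast+
  thus ?thesis by simp
qed
lemma perfect_matching_disjoint:
  assumes "perfect_matching G M" "e \<in> M" "f \<in> M" "v \<in> e" "v \<in> f" "v \<in> verts G"
  shows "e = f"
proof -
  have "\<exists>!e. e \<in> M \<and> v \<in> e"
    using assms(1,6) by (simp add: perfect_matching_def)
  thus ?thesis using assms(2-5) by blast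
qed

text \<open>
  Consecutive edges of the cycle share a vertex, so they cannot lie in the same matching: the cycle
  alternates between \<open>M\<close> and \<open>N\<close>. Which of the two contains the first edge is a matter of where the
  cycle starts.
\<close>
lemma flip_differences:
  assumes M: "perfect_matching G M" and N: "perfect_matching G N"
    and G: "\<And>e. e \<in> edges G \<Longrightarrow> e \<subseteq> verts G"
    and cycle: "is_cycle 4 (sym_diff M N)"
  shows "\<exists>a b c d. distinct [a, b, c, d] \<and> {a, b, c, d} \<subseteq> verts G \<and>
           M - N = {{a, b}, {c, d}} \<and> N - M = {{b, c}, {d, a}}"
proof -
  obtain vs where len: "length vs = 4" and dist: "distinct vs"
    and vs: "sym_diff M N = {{vs ! i, vs ! (Suc i mod 4)} | i. i < 4}"
    using cycle unfolding is_cycle_def by blast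
  obtain a b c d where vs_eq: "vs = [a, b, c, d]"
    using len by (auto simp: eval_nat_numeral length_Suc_conv)
  note abcd = vs_eq dist[unfolded vs_eq]
  have "{i::nat. i < 4} = {0, 1, 2, 3}" by auto
  hence "sym_diff M N = (\<lambda>i. {vs ! i, vs ! (Suc i mod 4)}) ` {0, 1, 2, 3}"
    unfolding vs by blast
  hence sd: "sym_diff M N = {{a, b}, {b, c}, {c, d}, {d, a}}"
    by (simp add: abcd(1))
  have MG: "e \<subseteq> verts G" if "e \<in> M \<union> N" for e
    using that M N G unfolding perfect_matching_def by blast
  have "{a, b} \<in> M \<union> N" "{c, d} \<in> M \<union> N"
    using sd by blast+
  hence sub: "{a, b, c, d} \<subseteq> verts G" using MG by blast
  have alternate: "e \<in> M - N \<longleftrightarrow> f \<in> N - M"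
    if "e \<in> sym_diff M N" "f \<in> sym_diff M N" "e \<noteq> f" "v \<in> e" "v \<in> f" "v \<in> verts G" for e f v
  proof -
    have "\<not> (e \<in> M \<and> f \<in> M)" "\<not> (e \<in> N \<and> f \<in> N)"
      using perfect_matching_disjoint[OF M _ _ that(4-6)]
        perfect_matching_disjoint[OF N _ _ that(4-6)] that(3) by metis+
    thus ?thesis using that(1,2) by blast
  qed
  have "{a, b} \<noteq> {b, c}" "{b, c} \<noteq> {c, d}" "{c, d} \<noteq> {d, a}"
    using abcd(2) by (auto simp: doubleton_eq_iff)
  hence alt: "{a, b} \<in> M - N \<longleftrightarrow> {b, c} \<in> N - M"
    "{b, c} \<in> M - N \<longleftrightarrow> {c, d} \<in> N - M"
    "{c, d} \<in> M - N \<longleftrightarrow> {d, a} \<in> N - M"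
    using alternate[of "{a, b}" "{b, c}" b] alternate[of "{b, c}" "{c, d}" c]
      alternate[of "{c, d}" "{d, a}" d] sub
    unfolding sd by simp_all
  have disjoint: "(M - N) \<inter> (N - M) = {}" by blast
  from alternating_union[OF sd disjoint alt] show ?thesis
  proof (elim disjE conjE)
    assume "M - N = {{a, b}, {c, d}}" "N - M = {{b, c}, {d, a}}"
    with abcd(2) sub show ?thesis by (intro exI conjI)
  next
    assume "M - N = {{b, c}, {d, a}}" "N - M = {{a, b}, {c, d}}"
    moreover from this(2) have "N - M = {{c, d}, {a, b}}"
      by (simp only: insert_commute)
    moreover have "distinct [b, c, d, a]" "{b, c, d, a} \<subseteq> verts G"
      using abcd(2) sub by auto
    ultimately show ?thesis by (intro exI conjI)
  qed
qed

lemma matching_weight_flip: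
  fixes x :: "'a \<Rightarrow> 'b::comm_ring_1"
  assumes "finite M" "finite N" "distinct [a, b, c, d]"
    and "M - N = {{a, b}, {c, d}}" "N - M = {{b, c}, {d, a}}"
  shows "matching_weight x M - matching_weight x N = (x a - x c) * (x b - x d)"
proof -
  let ?w = "\<lambda>e. \<Prod>v\<in>e. x v"
  have "sum ?w M = sum ?w (M - N) + sum ?w (M \<inter> N)"
    using assms(1) by (metis sum.Int_Diff add.commute)
  moreover have "sum ?w N = sum ?w (N - M) + sum ?w (M \<inter> N)"
    using assms(2) by (metis sum.Int_Diff add.commute Int_commute)
  ultimately have "sum ?w M - sum ?w N = sum ?w (M - N) - sum ?w (N - M)" by simp
  also have "\<dots> = (x a - x c) * (x b - x d)"
    using assms(3) not_sym[of a d] unfolding assms(4,5) by (simp add: doubleton_eq_iff algebra_simps)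
  finally show ?thesis by (simp add: matching_weight_def)
qed

text \<open>
  The vertex \<open>v\<close> carries the \<open>v\<close>-th representative \<open>x v\<close>, and \<open>r\<close> sends a polynomial to the number of
  its residue class, which is the colour.
\<close>
lemma flip_graph_proper_colouring:
  assumes "primepow q" and "m \<le> q"
  shows "\<exists>c. proper_colouring (flip_graph (complete_graph m)) q c"
proof -
  obtain P :: "int poly set" and x where "prime_ideal P"
    and repr: "\<And>f. \<exists>i<q. f - x i \<in> P"
    and incongruent: "\<And>i j. i < q \<Longrightarrow> j < q \<Longrightarrow> i \<noteq> j \<Longrightarrow> x i - x j \<notin> P"
    using exists_residue_field[OF assms(1)] by metis
  interpret P: prime_ideal P by fact
  obtain r where r: "\<And>f. r f < q" "\<And>f. f - x (r f) \<in> P"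
    using repr by metis
  let ?G = "complete_graph m"
  have fin: "finite M" if "perfect_matching ?G M" for M
  proof (rule finite_subset)
    show "M \<subseteq> [{..<m}]\<^bsup>2\<^esup>"
      using that by (simp add: perfect_matching_def complete_graph_def)
  qed (simp add: finite_imp_finite_nsets)
  have differ: "r (matching_weight x M) \<noteq> r (matching_weight x N)"
    if M: "perfect_matching ?G M" and N: "perfect_matching ?G N"
      and cycle: "is_cycle 4 (sym_diff M N)" for M N
  proof
    have "e \<subseteq> verts ?G" if "e \<in> edges ?G" for e
      using that by (auto simp: complete_graph_def nsets_def)
    from flip_differences[OF M N this cycle] obtain a b c d
      where abcd: "distinct [a, b, c, d]" "{a, b, c, d} \<subseteq> {..<m}"
        and diffs: "M - N = {{a, b}, {c, d}}" "N - M = {{b, c}, {d, a}}"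
      by (auto simp: complete_graph_def)
    assume eq: "r (matching_weight x M) = r (matching_weight x N)"
    have "matching_weight x M - matching_weight x N \<in> P"
      using P.diff_mem[OF r(2)[of "matching_weight x M"] r(2)[of "matching_weight x N"]]
      by (simp add: eq)
    hence "(x a - x c) * (x b - x d) \<in> P"
      unfolding matching_weight_flip[OF fin[OF M] fin[OF N] abcd(1) diffs] .
    moreover have "x a - x c \<notin> P" "x b - x d \<notin> P"
      using abcd assms(2) incongruent[of a c] incongruent[of b d] by auto
    ultimately show False using P.prime_mem by blast
  qed
  have "proper_colouring (flip_graph ?G) q (\<lambda>M. r (matching_weight x M))"
    unfolding proper_colouring_def
  proof (intro conjI ballI allI impI)
    fix M N assume "{M, N} \<in> edges (flip_graph ?G)"
    then obtain M' N' where "{M, N} = {M', N'}" "perfect_matching ?G M'"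
      "perfect_matching ?G N'" "is_cycle 4 (sym_diff M' N')"
      by (auto simp: flip_graph_def)
    thus "r (matching_weight x M) \<noteq> r (matching_weight x N)"
      using differ[of M' N'] by (auto simp: doubleton_eq_iff)
  qed (rule r(1))
  thus ?thesis by blast
qed

theorem theorem1p2:
  fixes n q :: nat
  assumes "n \<ge> 3"
    and "primepow q" and "q \<ge> 2 * n + 1"
    and "\<And>r :: nat. primepow r \<Longrightarrow> r \<ge> 2 * n + 1 \<Longrightarrow> q \<le> r"
  shows "chromatic_number (flip_graph (complete_graph (2 * n))) \<le> enat q"
  unfolding chromatic_number_def
proof (rule INF_lower)
  show "q \<in> {k. \<exists>c. proper_colouring (flip_graph (complete_graph (2 * n))) k c}"
    unfolding mem_Collect_eq
    by (rule flip_graph_proper_colouring[OF assms(2)]) (use assms(3) in linarith)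
qed

end
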